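(* Let $k$ be a field, let $a_1,\dots,a_v$ ($v>0$) be positive integers with $\operatorname{GCD}(a_1,\dots,a_v)=1$, let $H=\langle a_1,\dots,a_v\rangle$ and assume $1\notin H$. Let $R=k[H]=k[t^{a_1},\dots,t^{a_v}]\subseteq k[t]$. Let $0\ne\alpha\in k$ and let $M_\alpha=(\alpha^{a_i}-t^{a_i}\mid 1\le i\le v)$, an ideal of $R$. Then $$M_\alpha=(\alpha^a-t^a,\ \alpha^b-t^b)$$ for all $a,b\in H$ with $a>0$, $b>0$ and $\operatorname{GCD}(a,b)=1$.
   Context: $\langle a_1,\dots,a_v\rangle=\{\sum_{i=1}^v c_ia_i\mid 0\le c_i\in\mathbb Z\}$ is the numerical semigroup generated by the $a_i$. All ideals $(\,\cdots)$ are ideals of $R$ generated by the listed elements. *)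

theory Defs
  imports "HOL-Algebra.Algebraic_Closure_Type" "HOL-Algebra.Generated_Rings"
    "HOL-Computational_Algebra.Polynomial"
begin

definition numerical_semigroup :: "nat \<Rightarrow> (nat \<Rightarrow> nat) \<Rightarrow> nat set" where
  "numerical_semigroup v a = {\<Sum>i = 1..v. c i * a i | c :: nat \<Rightarrow> nat. True}"

(* k[t^s | s \<in> S], the k-subalgebra of k[t] generated by the monomials t^s, as a ring record:
   the subring generated by the constants together with these monomials. *)
definition monomial_algebra :: "nat set \<Rightarrow> 'k::field poly ring" where
  "monomial_algebra S =
     ring_of_type_algebra \<lparr> carrier :=
       generate_ring ring_of_type_algebra (range (\<lambda>c. [:c:]) \<union> Polynomial.monom 1 ` S) \<rparr>"

(* \<alpha>^n - t^n *)
definition binom_poly :: "'k::field \<Rightarrow> nat \<Rightarrow> 'k poly" where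
  "binom_poly \<alpha> n = [:\<alpha> ^ n:] - Polynomial.monom 1 n"

lemma monomial_algebra_cring: "cring (monomial_algebra S :: 'k::field poly ring)"
proof -
  interpret cring "ring_of_type_algebra :: 'k poly ring" ..
  have "subring (generate_ring ring_of_type_algebra
          (range (\<lambda>c. [:c:]) \<union> Polynomial.monom 1 ` S)) (ring_of_type_algebra :: 'k poly ring)"
    by (rule generate_ring_is_subring) (simp add: ring_of_type_algebra_def)
  then have "subcring (generate_ring ring_of_type_algebra
          (range (\<lambda>c. [:c:]) \<union> Polynomial.monom 1 ` S)) (ring_of_type_algebra :: 'k poly ring)"
    by (rule subcringI')
  then show ?thesis
    unfolding monomial_algebra_def by (rule subcring_iff[THEN iffD1, rotated])
       (simp add: ring_of_type_algebra_def)
qed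

lemma numerical_semigroup_zero: "0 \<in> numerical_semigroup v a"
  unfolding numerical_semigroup_def by (auto intro!: exI[of _ "\<lambda>_. 0"])

lemma numerical_semigroup_add:
  assumes "m \<in> numerical_semigroup v a" "n \<in> numerical_semigroup v a"
  shows "m + n \<in> numerical_semigroup v a"
proof -
  obtain c d where "m = (\<Sum>i = 1..v. c i * a i)" "n = (\<Sum>i = 1..v. d i * a i)"
    using assms unfolding numerical_semigroup_def by blast
  then have "m + n = (\<Sum>i = 1..v. (c i + d i) * a i)"
    by (simp add: sum.distrib algebra_simps)
  then show ?thesis
    unfolding numerical_semigroup_def mem_Collect_eq by (intro exI[of _ "\<lambda>i. c i + d i"] conjI) simp_all
qed

lemma numerical_semigroup_generator:
  assumes "i \<in> {1..v}" shows "a i \<in> numerical_semigroup v a"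
proof -
  have "(\<Sum>j = 1..v. (if j = i then 1 else 0) * a j) = (\<Sum>j = 1..v. if j = i then a j else 0)"
    by (rule sum.cong) auto
  also have "\<dots> = a i" using assms by simp
  finally have "a i = (\<Sum>j = 1..v. (if j = i then 1 else 0) * a j)" ..
  then show ?thesis
    unfolding numerical_semigroup_def mem_Collect_eq by (intro exI conjI) auto
qed

lemma generate_ring_sum:
  fixes f :: "'b \<Rightarrow> 'k::field poly"
  assumes "finite A" "0 \<in> generate_ring ring_of_type_algebra G"
    "\<And>x. x \<in> A \<Longrightarrow> f x \<in> generate_ring ring_of_type_algebra G"
  shows "sum f A \<in> generate_ring ring_of_type_algebra G"
  using assms(1,3)
proof (induction A rule: finite_induct)
  case empty
  then show ?case using assms(2) by simp
next
  case (insert x A)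
  then have "f x \<in> generate_ring ring_of_type_algebra G"
    "sum f A \<in> generate_ring ring_of_type_algebra G" by auto
  from generate_ring.eng_add[OF this] insert.hyps show ?case
    by (simp add: ring_of_type_algebra_def)
qed

lemma carrier_monomial_algebra_generators:
  "carrier (monomial_algebra (a ` {1..v}) :: 'k::field poly ring) =
     {p. \<forall>n. Polynomial.coeff p n \<noteq> 0 \<longrightarrow> n \<in> numerical_semigroup v a}"
    (is "_ = ?P")
proof -
  let ?T = "ring_of_type_algebra :: 'k poly ring"
  let ?G = "range (\<lambda>c. [:c:]) \<union> Polynomial.monom (1::'k) ` a ` {1..v}"
  interpret cring ?T ..
  have carr: "carrier (monomial_algebra (a ` {1..v}) :: 'k poly ring) = generate_ring ?T ?G"
    by (simp add: monomial_algebra_def)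
  have T: "\<one>\<^bsub>?T\<^esub> = 1" "\<zero>\<^bsub>?T\<^esub> = 0" "\<And>x y. x \<otimes>\<^bsub>?T\<^esub> y = x * y"
    "\<And>x y. x \<oplus>\<^bsub>?T\<^esub> y = x + y" "carrier ?T = UNIV"
    by (simp_all add: ring_of_type_algebra_def)
  have Tm: "\<ominus>\<^bsub>?T\<^esub> x = - x" for x
    by (rule minus_equality) (simp_all add: T)
  have "p \<in> ?P" if "p \<in> generate_ring ?T ?G" for p
    using that
  proof (induction rule: generate_ring.induct)
    case one
    then show ?case by (auto simp: T numerical_semigroup_zero coeff_1)
  next
    case (incl h)
    then show ?case
      by (auto simp: numerical_semigroup_zero coeff_pCons numerical_semigroup_generator
               split: if_splits nat.splits)
  next
    case (a_inv h)
    then show ?case by (simp add: Tm)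
  next
    case (eng_add h1 h2)
    then show ?case by (auto simp: T) (metis add.right_neutral)
  next
    case (eng_mult h1 h2)
    show ?case
    proof (intro CollectI allI impI)
      fix n assume "Polynomial.coeff (h1 \<otimes>\<^bsub>?T\<^esub> h2) n \<noteq> 0"
      then have "(\<Sum>i\<le>n. Polynomial.coeff h1 i * Polynomial.coeff h2 (n - i)) \<noteq> 0" by (simp add: T coeff_mult)
      then obtain i where "i \<le> n" "Polynomial.coeff h1 i * Polynomial.coeff h2 (n - i) \<noteq> 0"
        by (meson atMost_iff sum.not_neutral_contains_not_neutral)
      then have "i + (n - i) \<in> numerical_semigroup v a"
        using eng_mult.IH by (intro numerical_semigroup_add) auto
      then show "n \<in> numerical_semigroup v a" using \<open>i \<le> n\<close> by simp
    qed
  qed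
  moreover have "p \<in> generate_ring ?T ?G" if "p \<in> ?P" for p
  proof -
    let ?X = "generate_ring ?T ?G"
    have zero: "0 \<in> ?X" using zero_in_generate[of ?G] by (simp add: T)
    have mult: "x * y \<in> ?X" if "x \<in> ?X" "y \<in> ?X" for x y
      using generate_ring.eng_mult[OF that] by (simp add: T)
    have one: "1 \<in> ?X" using generate_ring.one[of ?T ?G] by (simp add: T)
    have const: "[:c:] \<in> ?X" for c by (rule generate_ring.incl) auto
    have pow: "Polynomial.monom 1 (c * a i) \<in> ?X" if "i \<in> {1..v}" for i c
    proof (induction c)
      case 0
      then show ?case using one by simp
    next
      case (Suc c)
      have "Polynomial.monom 1 (a i) \<in> ?X" by (rule generate_ring.incl) (use that in auto)
      from mult[OF this Suc] show ?case by (simp add: mult_monom)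
    qed
    have "Polynomial.monom 1 (\<Sum>i\<in>A. c i * a i) \<in> ?X" if "finite A" "A \<subseteq> {1..v}" for A c
      using that
    proof (induction A rule: finite_induct)
      case empty
      then show ?case using one by simp
    next
      case (insert i A)
      then have "Polynomial.monom 1 (c i * a i) * Polynomial.monom 1 (\<Sum>i\<in>A. c i * a i) \<in> ?X"
        by (intro mult pow) auto
      then show ?case using insert.hyps by (simp add: mult_monom)
    qed
    then have mon: "Polynomial.monom 1 n \<in> ?X" if "n \<in> numerical_semigroup v a" for n
      using that unfolding numerical_semigroup_def by auto
    have "Polynomial.monom (Polynomial.coeff p n) n \<in> ?X" for n
    proof (cases "Polynomial.coeff p n = 0")
      case True
      then show ?thesis using zero by simp
    next
      case False
      then have "[:Polynomial.coeff p n:] * Polynomial.monom 1 n \<in> ?X"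
        using \<open>p \<in> ?P\<close> by (intro mult const mon) auto
      then show ?thesis by (simp add: smult_monom)
    qed
    then have "(\<Sum>n\<le>Polynomial.degree p. Polynomial.monom (Polynomial.coeff p n) n) \<in> ?X"
      by (intro generate_ring_sum zero) auto
    then show ?thesis by (simp add: poly_as_sum_of_monoms)
  qed
  ultimately show ?thesis unfolding carr by blast
qed

(* k[H] = k[t^a_1, ..., t^a_v] for H = <a_1, ..., a_v> *)
lemma monomial_algebra_numerical_semigroup:
  "(monomial_algebra (numerical_semigroup v a) :: 'k::field poly ring) =
     monomial_algebra (a ` {1..v})"
proof -
  let ?T = "ring_of_type_algebra :: 'k poly ring"
  interpret cring ?T ..
  let ?G = "\<lambda>S. range (\<lambda>c. [:c:]) \<union> Polynomial.monom (1::'k) ` S"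
  let ?H = "numerical_semigroup v a"
  have carr: "carrier (monomial_algebra S :: 'k poly ring) = generate_ring ?T (?G S)" for S
    by (simp add: monomial_algebra_def)
  have UNIV: "carrier ?T = UNIV" by (simp add: ring_of_type_algebra_def)
  have "?G (a ` {1..v}) \<subseteq> ?G ?H" using numerical_semigroup_generator by blast
  then have 1: "generate_ring ?T (?G (a ` {1..v})) \<subseteq> generate_ring ?T (?G ?H)"
    by (intro mono_generate_ring) (auto simp: UNIV)
  have "?G ?H \<subseteq> generate_ring ?T (?G (a ` {1..v}))"
    unfolding carr[symmetric] carrier_monomial_algebra_generators
    by (auto simp: coeff_pCons numerical_semigroup_zero split: if_splits nat.splits)
  then have 2: "generate_ring ?T (?G ?H) \<subseteq> generate_ring ?T (?G (a ` {1..v}))"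
    by (intro generate_ring_min_subring1 generate_ring_is_subring) (auto simp: UNIV)
  from 1 2 show ?thesis unfolding monomial_algebra_def by simp
qed

lemma binom_poly_in_carrier:
  assumes "n \<in> numerical_semigroup v a"
  shows "binom_poly \<alpha> n \<in> carrier (monomial_algebra (a ` {1..v}))"
  using assms unfolding carrier_monomial_algebra_generators binom_poly_def
  by (auto simp: coeff_pCons numerical_semigroup_zero split: if_splits nat.splits)

end

(* Modulo any ideal I of R = k[H], the exponents n in H with t^n = alpha^n form a submonoid of H
   that is closed under differences within H, because alpha is a unit. The left-hand ideal puts all
   a_i into this submonoid, hence all of H. The right-hand ideal puts b and c into it; as b and c
   are coprime, every n in H can be written as n = x b - y c with natural x and y, so again the
   submonoid is all of H. *)
theory Submission
  imports Defs
begin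

text \<open>Insert the mixed term \<alpha>^m t^n between \<alpha>^(m+n) and t^(m+n). Of the two
  cofactors, one is a constant and the other is t^n, so only the exponent n has to lie in H for both
  to be elements of R.\<close>

lemma binom_poly_add:
  "binom_poly \<alpha> (m + n) = [:\<alpha> ^ m:] * binom_poly \<alpha> n + Polynomial.monom 1 n * binom_poly \<alpha> m"
  by (simp add: binom_poly_def algebra_simps mult_monom power_add smult_monom)

lemma const_in_monomial_algebra:
  fixes v :: nat
  shows "[:x:] \<in> carrier (monomial_algebra (a ` {1..v}))"
  unfolding carrier_monomial_algebra_generators
  by (auto simp: coeff_pCons numerical_semigroup_zero split: nat.splits)

lemma monom_in_monomial_algebra:
  assumes "n \<in> numerical_semigroup v a"
  shows "Polynomial.monom x n \<in> carrier (monomial_algebra (a ` {1..v}))"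
  using assms unfolding carrier_monomial_algebra_generators by auto

text \<open>This and the next two lemmas restate the ideal axioms with the ordinary operations on
  polynomials, so that identities in k[t] can be applied directly.\<close>

lemma monomial_algebra_ideal_add:
  assumes "ideal I (monomial_algebra S)" "p \<in> I" "q \<in> I"
  shows "p + q \<in> I"
  using additive_subgroup.a_closed[OF ideal.axioms(1)[OF assms(1)] assms(2,3)]
  by (simp add: monomial_algebra_def ring_of_type_algebra_def)

lemma monomial_algebra_ideal_mult:
  assumes "ideal I (monomial_algebra S)" "p \<in> I" "r \<in> carrier (monomial_algebra S)"
  shows "r * p \<in> I"
  using ideal.I_l_closed[OF assms]
  by (simp add: monomial_algebra_def ring_of_type_algebra_def)

lemma monomial_algebra_ideal_zero:
  assumes "ideal I (monomial_algebra S)"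
  shows "0 \<in> I"
  using additive_subgroup.zero_closed[OF ideal.axioms(1)[OF assms]]
  by (simp add: monomial_algebra_def ring_of_type_algebra_def)

context
  fixes v :: nat and a :: "nat \<Rightarrow> nat" and \<alpha> :: "'k::field" and I :: "'k poly set"
  assumes ideal_I: "ideal I (monomial_algebra (a ` {1..v}))"
begin

lemma binom_poly_add_in_ideal:
  assumes "n \<in> numerical_semigroup v a" "binom_poly \<alpha> m \<in> I" "binom_poly \<alpha> n \<in> I"
  shows "binom_poly \<alpha> (m + n) \<in> I"
  unfolding binom_poly_add
  by (intro monomial_algebra_ideal_add[OF ideal_I] monomial_algebra_ideal_mult[OF ideal_I]
      const_in_monomial_algebra monom_in_monomial_algebra assms)

lemma binom_poly_mult_in_ideal:
  assumes "n \<in> numerical_semigroup v a" "binom_poly \<alpha> n \<in> I"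
  shows "binom_poly \<alpha> (x * n) \<in> I"
proof (induction x)
  case 0
  \<comment> \<open>The exponent 0 gives the zero polynomial, since \<alpha>^0 = t^0 = 1.\<close>
  then show ?case
    using monomial_algebra_ideal_zero[OF ideal_I] by (simp add: binom_poly_def one_pCons)
next
  case (Suc x)
  then show ?case
    using binom_poly_add_in_ideal[OF assms(1) Suc assms(2)] by (simp add: add.commute)
qed

text \<open>Solve \<open>binom_poly_add\<close> for its term with the constant cofactor \<alpha>^m,
  which is a unit of R because \<alpha> is nonzero. The remaining cofactor -t^n lies in R because n
  is in H.\<close>

lemma binom_poly_diff_in_ideal:
  assumes "\<alpha> \<noteq> 0" "n \<in> numerical_semigroup v a"
    and "binom_poly \<alpha> (m + n) \<in> I" "binom_poly \<alpha> m \<in> I"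
  shows "binom_poly \<alpha> n \<in> I"
proof -
  have "[:\<alpha> ^ m:] * binom_poly \<alpha> n =
      binom_poly \<alpha> (m + n) + Polynomial.monom (- 1) n * binom_poly \<alpha> m"
    by (simp add: binom_poly_add flip: minus_monom)
  also have "\<dots> \<in> I"
    by (intro monomial_algebra_ideal_add[OF ideal_I] monomial_algebra_ideal_mult[OF ideal_I]
        monom_in_monomial_algebra assms)
  finally have "[:inverse (\<alpha> ^ m):] * ([:\<alpha> ^ m:] * binom_poly \<alpha> n) \<in> I"
    by (rule monomial_algebra_ideal_mult[OF ideal_I]) (rule const_in_monomial_algebra)
  then show ?thesis using assms(1) by simp
qed

lemma binom_poly_in_ideal_of_generators:
  assumes "\<And>i. i \<in> {1..v} \<Longrightarrow> binom_poly \<alpha> (a i) \<in> I" "n \<in> numerical_semigroup v a"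
  shows "binom_poly \<alpha> n \<in> I"
proof -
  obtain x where n: "n = (\<Sum>i = 1..v. x i * a i)"
    using assms(2) unfolding numerical_semigroup_def by blast
  \<comment> \<open>Passing to arbitrary index sets A allows adding one generator at a time.\<close>
  have "binom_poly \<alpha> (\<Sum>i\<in>A. x i * a i) \<in> I" if "finite A" "A \<subseteq> {1..v}" for A
    using that
  proof (induction A rule: finite_induct)
    case empty
    then show ?case
      using monomial_algebra_ideal_zero[OF ideal_I] by (simp add: binom_poly_def one_pCons)
  next
    case (insert i A)
    \<comment> \<open>The new multiple is to be the second summand in
      \<open>binom_poly_add_in_ideal\<close>, whose exponent must lie in H; the witness is the
      coefficient family supported at i.\<close>
    have "x i * a i \<in> numerical_semigroup v a"
      unfolding numerical_semigroup_def mem_Collect_eq using insert.prems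
      by (intro exI[of _ "\<lambda>j. if j = i then x i else 0"])
         (simp add: if_distrib[of "\<lambda>y. y * _"] cong: if_cong)
    moreover have "binom_poly \<alpha> (x i * a i) \<in> I"
      using insert.prems assms(1) numerical_semigroup_generator
      by (intro binom_poly_mult_in_ideal) auto
    ultimately have "binom_poly \<alpha> ((\<Sum>i\<in>A. x i * a i) + x i * a i) \<in> I"
      using insert by (intro binom_poly_add_in_ideal) auto
    then show ?case using insert.hyps by (simp add: add.commute)
  qed
  then show ?thesis unfolding n by blast
qed

lemma binom_poly_in_ideal_of_coprime:
  assumes "\<alpha> \<noteq> 0" "b \<in> numerical_semigroup v a" "c \<in> numerical_semigroup v a"
    and "b > 0" "gcd b c = 1" "binom_poly \<alpha> b \<in> I" "binom_poly \<alpha> c \<in> I"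
    and "n \<in> numerical_semigroup v a"
  shows "binom_poly \<alpha> n \<in> I"
proof -
  \<comment> \<open>Bezout with natural coefficients, which is where b > 0 enters.\<close>
  obtain x y where "b * x = c * y + 1"
    using bezout_nat[of b c] assms(4,5) by auto
  \<comment> \<open>Scaling by n exhibits n as a multiple of b minus a multiple of c; the difference
    lemma is then used with m = (n y) c.\<close>
  then have "(n * x) * b = (n * y) * c + n"
    by (metis add_mult_distrib2 mult.assoc mult.commute nat_mult_1_right)
  then show ?thesis
    using binom_poly_diff_in_ideal[OF assms(1,8)] binom_poly_mult_in_ideal assms(2,3,6,7) by metis
qed

end

theorem corollary4p4:
  fixes v :: nat and a :: "nat \<Rightarrow> nat" and \<alpha> :: "'k::field" and b c :: nat
  assumes "v > 0"
    and "\<forall>i\<in>{1..v}. a i > 0"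
    and "Gcd (a ` {1..v}) = 1"
    and "1 \<notin> numerical_semigroup v a"
    and "\<alpha> \<noteq> 0"
    and "b \<in> numerical_semigroup v a" and "c \<in> numerical_semigroup v a"
    and "b > 0" and "c > 0" and "gcd b c = 1"
  shows "Idl\<^bsub>monomial_algebra (a ` {1..v})\<^esub> ((\<lambda>i. binom_poly \<alpha> (a i)) ` {1..v})
       = Idl\<^bsub>monomial_algebra (a ` {1..v})\<^esub> {binom_poly \<alpha> b, binom_poly \<alpha> c}"
proof -
  let ?R = "monomial_algebra (a ` {1..v}) :: 'k poly ring"
  let ?A = "(\<lambda>i. binom_poly \<alpha> (a i)) ` {1..v}" and ?B = "{binom_poly \<alpha> b, binom_poly \<alpha> c}"
  interpret R: cring ?R by (rule monomial_algebra_cring)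
  have carr: "?A \<subseteq> carrier ?R" "?B \<subseteq> carrier ?R"
    using binom_poly_in_carrier numerical_semigroup_generator assms(6,7) by blast+
  note ideals = carr[THEN R.genideal_ideal]
  note self = carr[THEN R.genideal_self]
  \<comment> \<open>By minimality of generated ideals, it suffices that each generating set lies in
    the ideal generated by the other.\<close>
  have "?B \<subseteq> Idl\<^bsub>?R\<^esub> ?A"
    using binom_poly_in_ideal_of_generators[OF ideals(1)] self(1) assms(6,7) by blast
  moreover have "?A \<subseteq> Idl\<^bsub>?R\<^esub> ?B"
    using binom_poly_in_ideal_of_coprime[OF ideals(2) assms(5-8,10)] self(2)
      numerical_semigroup_generator by blast
  ultimately show ?thesis
    using ideals by (intro subset_antisym R.genideal_minimal)
qed

end
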